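(* Let $(X,\|\cdot\|)$ be a complex normed space. Regarding $\perp_{\rho_\infty}$ and $\perp_B$ as binary relations on $X$, the following conditions are equivalent: (i) $|\rho_\infty(x,y)|\leq\|x\|\,\|y\|$ for all $x,y\in X$; (ii) $\perp_{\rho_\infty}\subseteq\perp_B$.
   Context: For a complex normed space $X$ and $x,y\in X$, the right norm derivative is $\rho_{+}(x,y)=\lim_{t\to0^{+}}\frac{\|x+ty\|^2-\|x\|^2}{2t}\in\mathbb{R}$, and $$\rho_{\infty}(x,y)=\frac1\pi\int_0^{2\pi}e^{i\theta}\rho_{+}(x,e^{i\theta}y)\,d\theta\in\mathbb{C}.$$ The relations are: $x\perp_{\rho_\infty}y$ iff $\rho_\infty(x,y)=0$; $x\perp_B y$ (Birkhoff--James orthogonality) iff $\|x\|\le\|x+\xi y\|$ for all $\xi\in\mathbb{C}$. *)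

theory Defs
  imports "HOL-Analysis.Analysis"
begin

text \<open>A complex normed space is a real normed space whose real scalar multiplication is the
  restriction of a complex one, with absolutely homogeneous norm over the complex scalars.\<close>

class complex_normed_vector = real_normed_vector +
  fixes scaleC :: "complex \<Rightarrow> 'a \<Rightarrow> 'a" (infixr "*\<^sub>C" 75)
  assumes scaleR_scaleC: "r *\<^sub>R x = complex_of_real r *\<^sub>C x"
    and scaleC_add_right: "a *\<^sub>C (x + y) = a *\<^sub>C x + a *\<^sub>C y"
    and scaleC_add_left: "(a + b) *\<^sub>C x = a *\<^sub>C x + b *\<^sub>C x"
    and scaleC_scaleC: "a *\<^sub>C (b *\<^sub>C x) = (a * b) *\<^sub>C x"
    and scaleC_one: "1 *\<^sub>C x = x"
    and norm_scaleC: "norm (a *\<^sub>C x) = cmod a * norm x"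

text \<open>The one-sided limit always exists, because \<open>t \<mapsto> (norm (x + t *\<^sub>R y))\<^sup>2\<close> is convex.\<close>

definition rho_plus :: "'a::complex_normed_vector \<Rightarrow> 'a \<Rightarrow> real" where
  "rho_plus x y =
     Lim (at_right 0) (\<lambda>t::real. ((norm (x + t *\<^sub>R y))\<^sup>2 - (norm x)\<^sup>2) / (2 * t))"

text \<open>The integrand is continuous in \<open>\<theta>\<close>, so the integral never takes its default value.\<close>

definition rho_infty :: "'a::complex_normed_vector \<Rightarrow> 'a \<Rightarrow> complex" where
  "rho_infty x y =
     complex_of_real (1 / pi) *
       integral {0..2 * pi} (\<lambda>\<theta>. cis \<theta> * complex_of_real (rho_plus x (cis \<theta> *\<^sub>C y)))"

definition rho_infty_orthogonal :: "('a::complex_normed_vector \<times> 'a) set" where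
  "rho_infty_orthogonal = {(x, y). rho_infty x y = 0}"

definition birkhoff_james_orthogonal :: "('a::complex_normed_vector \<times> 'a) set" where
  "birkhoff_james_orthogonal = {(x, y). \<forall>\<xi>::complex. norm x \<le> norm (x + \<xi> *\<^sub>C y)}"

end

theory Submission
  imports Defs
begin

text \<open>The map \<open>\<rho>\<^sub>+(x, \<cdot>)\<close> is sublinear and satisfies \<open>\<rho>\<^sub>+(x, c x + y) = Re c \<parallel>x\<parallel>\<^sup>2 + \<rho>\<^sub>+(x, y)\<close>
  because it is linear on the complex line through \<open>x\<close>. Hence
  \<open>\<rho>\<^sub>\<infinity>(x, c x + y) = cnj c \<parallel>x\<parallel>\<^sup>2 + \<rho>\<^sub>\<infinity>(x, y)\<close>, and \<open>\<rho>\<^sub>\<infinity>(x, \<cdot>)\<close> is conjugate homogeneous.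
  Under (i), if \<open>\<rho>\<^sub>\<infinity>(x, y) = 0\<close> then \<open>\<parallel>x\<parallel>\<^sup>2 = \<bar>\<rho>\<^sub>\<infinity>(x, x + \<xi> y)\<bar> \<le> \<parallel>x\<parallel> \<parallel>x + \<xi> y\<parallel>\<close>.
  Conversely, for \<open>x \<noteq> 0\<close> the number \<open>c = - cnj (\<rho>\<^sub>\<infinity>(x, y)) / \<parallel>x\<parallel>\<^sup>2\<close> makes \<open>\<rho>\<^sub>\<infinity>(x, c x + y)\<close> vanish,
  and Birkhoff--James orthogonality of \<open>x\<close> and \<open>c x + y\<close>, tested at \<open>\<xi> = -1/c\<close>, gives
  \<open>\<parallel>x\<parallel> \<le> \<parallel>y\<parallel> / \<bar>c\<bar>\<close>.\<close>

section \<open>Convexity of the squared norm\<close>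

lemma power2_convex_combination_le:
  fixes a b u :: real
  assumes "0 \<le> u" "u \<le> 1"
  shows "((1 - u) * a + u * b)\<^sup>2 \<le> (1 - u) * a\<^sup>2 + u * b\<^sup>2"
proof -
  have "(1 - u) * a\<^sup>2 + u * b\<^sup>2 - ((1 - u) * a + u * b)\<^sup>2 = u * (1 - u) * (a - b)\<^sup>2"
    by (simp add: power2_eq_square algebra_simps)
  moreover have "0 \<le> u * (1 - u) * (a - b)\<^sup>2"
    using assms by simp
  ultimately show ?thesis by linarith
qed

lemma norm_power2_convex_combination_le:
  fixes x y :: "'a::real_normed_vector"
  assumes "0 \<le> u" "u \<le> 1"
  shows "(norm ((1 - u) *\<^sub>R x + u *\<^sub>R y))\<^sup>2 \<le> (1 - u) * (norm x)\<^sup>2 + u * (norm y)\<^sup>2"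
proof -
  have "norm ((1 - u) *\<^sub>R x + u *\<^sub>R y) \<le> (1 - u) * norm x + u * norm y"
    using norm_triangle_ineq[of "(1 - u) *\<^sub>R x" "u *\<^sub>R y"] assms by simp
  then have "(norm ((1 - u) *\<^sub>R x + u *\<^sub>R y))\<^sup>2 \<le> ((1 - u) * norm x + u * norm y)\<^sup>2"
    by (intro power_mono) auto
  also have "\<dots> \<le> (1 - u) * (norm x)\<^sup>2 + u * (norm y)\<^sup>2"
    using assms by (rule power2_convex_combination_le)
  finally show ?thesis .
qed

section \<open>Difference quotients of the squared norm\<close>

definition sq_norm_quot :: "'a::real_normed_vector \<Rightarrow> 'a \<Rightarrow> real \<Rightarrow> real" where
  "sq_norm_quot x y t = ((norm (x + t *\<^sub>R y))\<^sup>2 - (norm x)\<^sup>2) / (2 * t)"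

text \<open>Chord slopes of a convex function increase: \<open>x + s *\<^sub>R y\<close> is the
  convex combination of \<open>x\<close> and \<open>x + t *\<^sub>R y\<close> with weight
  \<open>s / t\<close> on the latter.\<close>

lemma sq_norm_quot_mono:
  assumes "0 < s" "s \<le> t"
  shows "sq_norm_quot x y s \<le> sq_norm_quot x y t"
proof -
  have "x + s *\<^sub>R y = (1 - s / t) *\<^sub>R x + (s / t) *\<^sub>R (x + t *\<^sub>R y)"
    using assms by (simp add: algebra_simps)
  then have "(norm (x + s *\<^sub>R y))\<^sup>2 \<le> (1 - s / t) * (norm x)\<^sup>2 + (s / t) * (norm (x + t *\<^sub>R y))\<^sup>2"
    using norm_power2_convex_combination_le[of "s / t" x "x + t *\<^sub>R y"] assms by simp
  then have "(norm (x + s *\<^sub>R y))\<^sup>2 - (norm x)\<^sup>2 \<le> (s / t) * ((norm (x + t *\<^sub>R y))\<^sup>2 - (norm x)\<^sup>2)"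
    by (simp add: algebra_simps)
  then have "((norm (x + s *\<^sub>R y))\<^sup>2 - (norm x)\<^sup>2) / (2 * s)
      \<le> (s / t) * ((norm (x + t *\<^sub>R y))\<^sup>2 - (norm x)\<^sup>2) / (2 * s)"
    using assms by (intro divide_right_mono) auto
  also have "\<dots> = ((norm (x + t *\<^sub>R y))\<^sup>2 - (norm x)\<^sup>2) / (2 * t)"
    using assms by simp
  finally show ?thesis by (simp add: sq_norm_quot_def)
qed

text \<open>Ensures that the quotients have an infimum. If the norm drops along the step, both
  factors of the difference of squares are nonnegative and at most \<open>t * norm y\<close> and
  \<open>2 * norm x\<close>.\<close>

lemma sq_norm_quot_lower_bound:
  assumes "0 < t"
  shows "- (norm x * norm y) \<le> sq_norm_quot x y t"
proof -
  let ?a = "norm (x + t *\<^sub>R y)"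
  have "- (2 * t * (norm x * norm y)) \<le> ?a\<^sup>2 - (norm x)\<^sup>2"
  proof (cases "norm x \<le> ?a")
    case True
    then have "0 \<le> ?a\<^sup>2 - (norm x)\<^sup>2" by (simp add: power_mono)
    moreover have "0 \<le> 2 * t * (norm x * norm y)" using assms by simp
    ultimately show ?thesis by linarith
  next
    case False
    have "norm x - ?a \<le> t * norm y"
      using norm_triangle_ineq4[of "x + t *\<^sub>R y" "t *\<^sub>R y"] assms by simp
    then have "(norm x - ?a) * (norm x + ?a) \<le> (t * norm y) * (2 * norm x)"
      using False assms by (intro mult_mono) auto
    then show ?thesis by (simp add: power2_eq_square algebra_simps)
  qed
  then show ?thesis using assms by (simp add: sq_norm_quot_def field_simps)
qed

lemma sq_norm_quot_upper_bound:
  assumes "0 < t"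
  shows "sq_norm_quot x y t \<le> norm x * norm y + t * (norm y)\<^sup>2 / 2"
proof -
  have "norm (x + t *\<^sub>R y) \<le> norm x + t * norm y"
    using norm_triangle_ineq[of x "t *\<^sub>R y"] assms by simp
  then have "(norm (x + t *\<^sub>R y))\<^sup>2 \<le> (norm x + t * norm y)\<^sup>2"
    by (intro power_mono) auto
  then have "(norm (x + t *\<^sub>R y))\<^sup>2 - (norm x)\<^sup>2 \<le> 2 * t * (norm x * norm y + t * (norm y)\<^sup>2 / 2)"
    by (simp add: power2_eq_square algebra_simps)
  then show ?thesis using assms by (simp add: sq_norm_quot_def divide_le_eq mult.commute)
qed

text \<open>The point on the left is the midpoint of \<open>x + (2 * t) *\<^sub>R y\<close> and
  \<open>x + (2 * t) *\<^sub>R z\<close>. The doubled step is harmless in the limit.\<close>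

lemma sq_norm_quot_add_le:
  assumes "0 < t"
  shows "sq_norm_quot x (y + z) t \<le> sq_norm_quot x y (2 * t) + sq_norm_quot x z (2 * t)"
proof -
  have eq: "x + t *\<^sub>R (y + z)
      = (1 - 1/2) *\<^sub>R (x + (2 * t) *\<^sub>R y) + (1/2) *\<^sub>R (x + (2 * t) *\<^sub>R z)"
    by (simp add: algebra_simps flip: scaleR_add_left)
  have "(norm (x + t *\<^sub>R (y + z)))\<^sup>2
      \<le> (1 - 1/2) * (norm (x + (2 * t) *\<^sub>R y))\<^sup>2 + (1/2) * (norm (x + (2 * t) *\<^sub>R z))\<^sup>2"
    unfolding eq by (rule norm_power2_convex_combination_le) simp_all
  then have "(norm (x + t *\<^sub>R (y + z)))\<^sup>2 - (norm x)\<^sup>2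
      \<le> (((norm (x + (2 * t) *\<^sub>R y))\<^sup>2 - (norm x)\<^sup>2) + ((norm (x + (2 * t) *\<^sub>R z))\<^sup>2 - (norm x)\<^sup>2)) / 2"
    by simp
  then have "sq_norm_quot x (y + z) t
      \<le> (((norm (x + (2 * t) *\<^sub>R y))\<^sup>2 - (norm x)\<^sup>2) + ((norm (x + (2 * t) *\<^sub>R z))\<^sup>2 - (norm x)\<^sup>2)) / 2 / (2 * t)"
    using assms unfolding sq_norm_quot_def by (intro divide_right_mono) auto
  also have "\<dots> = sq_norm_quot x y (2 * t) + sq_norm_quot x z (2 * t)"
    by (simp add: sq_norm_quot_def add_divide_distrib diff_divide_distrib)
  finally show ?thesis .
qed

section \<open>The right norm derivative as a sublinear functional\<close>

text \<open>Monotone quotients bounded below converge to their infimum as \<open>t\<close> decreases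
  to 0, so the \<open>Lim\<close> in \<open>rho_plus\<close> is a genuine limit.\<close>

lemma tendsto_sq_norm_quot:
  "(sq_norm_quot x y \<longlongrightarrow> rho_plus x y) (at_right 0)"
proof -
  \<comment> \<open>The intersection with \<open>UNIV\<close> only matches the shape of
    \<open>Lim_right_bound\<close>.\<close>
  have "(sq_norm_quot x y \<longlongrightarrow> Inf (sq_norm_quot x y ` ({0<..} \<inter> UNIV)))
      (at 0 within ({0<..} \<inter> UNIV))"
    by (rule Lim_right_bound[where K = "- (norm x * norm y)"])
      (auto intro: sq_norm_quot_mono sq_norm_quot_lower_bound)
  then have lim: "(sq_norm_quot x y \<longlongrightarrow> Inf (sq_norm_quot x y ` {0<..})) (at_right 0)"
    by simp
  then have "rho_plus x y = Inf (sq_norm_quot x y ` {0<..})"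
    unfolding rho_plus_def sq_norm_quot_def[abs_def] by (intro tendsto_Lim) auto
  with lim show ?thesis by simp
qed

lemma filterlim_times_at_right_0:
  fixes r :: real
  assumes "0 < r"
  shows "filterlim (\<lambda>t. r * t) (at_right 0) (at_right 0)"
proof -
  have "((\<lambda>t. r * t) \<longlongrightarrow> r * 0) (at_right 0)"
    by (intro tendsto_intros)
  moreover have "eventually (\<lambda>t. r * t \<in> {0<..} \<and> r * t \<noteq> 0) (at_right 0)"
    using eventually_at_right_less[of "0::real"] by eventually_elim (use assms in auto)
  ultimately show ?thesis by (simp add: filterlim_at)
qed

lemma tendsto_sq_norm_quot_times:
  assumes "0 < r"
  shows "((\<lambda>t. sq_norm_quot x y (r * t)) \<longlongrightarrow> rho_plus x y) (at_right 0)"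
  by (rule filterlim_compose[OF tendsto_sq_norm_quot filterlim_times_at_right_0[OF assms]])

lemma rho_plus_upper_bound: "rho_plus x y \<le> norm x * norm y"
proof -
  have "((\<lambda>t. norm x * norm y + t * (norm y)\<^sup>2 / 2) \<longlongrightarrow> norm x * norm y + 0 * (norm y)\<^sup>2 / 2)
      (at_right 0)"
    by (intro tendsto_intros) auto
  then have "rho_plus x y \<le> norm x * norm y + 0 * (norm y)\<^sup>2 / 2"
    by (rule tendsto_le[OF trivial_limit_at_right_real _ tendsto_sq_norm_quot])
      (use eventually_at_right_less[of "0::real"] in eventually_elim,
        rule sq_norm_quot_upper_bound)
  then show ?thesis by simp
qed

lemma rho_plus_add_le: "rho_plus x (y + z) \<le> rho_plus x y + rho_plus x z"
proof (rule tendsto_le[OF trivial_limit_at_right_real _ tendsto_sq_norm_quot])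
  show "((\<lambda>t. sq_norm_quot x y (2 * t) + sq_norm_quot x z (2 * t))
      \<longlongrightarrow> rho_plus x y + rho_plus x z) (at_right 0)"
    by (intro tendsto_add tendsto_sq_norm_quot_times) auto
  show "\<forall>\<^sub>F t in at_right 0.
      sq_norm_quot x (y + z) t \<le> sq_norm_quot x y (2 * t) + sq_norm_quot x z (2 * t)"
    using eventually_at_right_less[of "0::real"] by eventually_elim (rule sq_norm_quot_add_le)
qed

lemma rho_plus_scaleR:
  assumes "0 < r"
  shows "rho_plus x (r *\<^sub>R y) = r * rho_plus x y"
proof (rule tendsto_unique[OF trivial_limit_at_right_real tendsto_sq_norm_quot])
  have "sq_norm_quot x (r *\<^sub>R y) t = r * sq_norm_quot x y (r * t)" for t
    using assms by (simp add: sq_norm_quot_def mult.commute)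
  then show "(sq_norm_quot x (r *\<^sub>R y) \<longlongrightarrow> r * rho_plus x y) (at_right 0)"
    using tendsto_mult_left[OF tendsto_sq_norm_quot_times[OF assms, of x y], of r]
    by presburger
qed

text \<open>On the complex line through \<open>x\<close> the norm is explicit: the factor
  \<open>1 + t * c\<close> has squared modulus quadratic in \<open>t\<close>, with linear
  coefficient \<open>2 * Re c\<close>.\<close>

lemma rho_plus_scaleC_self: "rho_plus x (c *\<^sub>C x) = Re c * (norm x)\<^sup>2"
proof (rule tendsto_unique[OF trivial_limit_at_right_real tendsto_sq_norm_quot])
  have quot: "(Re c + t * (cmod c)\<^sup>2 / 2) * (norm x)\<^sup>2 = sq_norm_quot x (c *\<^sub>C x) t" if "0 < t" for t
  proof -
    have "x + t *\<^sub>R (c *\<^sub>C x) = (1 + complex_of_real t * c) *\<^sub>C x"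
      by (simp add: scaleR_scaleC scaleC_add_left scaleC_scaleC scaleC_one)
    then have "(norm (x + t *\<^sub>R (c *\<^sub>C x)))\<^sup>2
        = (1 + 2 * t * Re c + t\<^sup>2 * (cmod c)\<^sup>2) * (norm x)\<^sup>2"
      by (simp add: norm_scaleC power_mult_distrib cmod_power2)
        (simp add: power2_eq_square algebra_simps)
    then show ?thesis
      using that by (simp add: sq_norm_quot_def power2_eq_square field_simps)
  qed
  have "((\<lambda>t. (Re c + t * (cmod c)\<^sup>2 / 2) * (norm x)\<^sup>2)
      \<longlongrightarrow> (Re c + 0 * (cmod c)\<^sup>2 / 2) * (norm x)\<^sup>2) (at_right 0)"
    by (intro tendsto_intros) auto
  moreover have "\<forall>\<^sub>F t in at_right 0.
      (Re c + t * (cmod c)\<^sup>2 / 2) * (norm x)\<^sup>2 = sq_norm_quot x (c *\<^sub>C x) t"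
    using eventually_at_right_less[of "0::real"] by eventually_elim (rule quot)
  ultimately show "(sq_norm_quot x (c *\<^sub>C x) \<longlongrightarrow> Re c * (norm x)\<^sup>2) (at_right 0)"
    by (simp add: tendsto_cong)
qed

lemma scaleC_zero_left [simp]: "0 *\<^sub>C x = 0"
  using scaleR_scaleC[of 0 x] by simp

lemma scaleC_minus_left: "(- a) *\<^sub>C x = - (a *\<^sub>C x)"
  using scaleC_add_left[of a "- a" x] by (simp add: minus_unique)

lemma scaleC_diff_left: "(a - b) *\<^sub>C x = a *\<^sub>C x - b *\<^sub>C x"
  using scaleC_add_left[of a "- b" x] by (simp add: scaleC_minus_left)

lemma rho_plus_scaleC_self_add:
  "rho_plus x (c *\<^sub>C x + y) = Re c * (norm x)\<^sup>2 + rho_plus x y"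
proof (rule antisym)
  show "rho_plus x (c *\<^sub>C x + y) \<le> Re c * (norm x)\<^sup>2 + rho_plus x y"
    using rho_plus_add_le[of x "c *\<^sub>C x" y] by (simp add: rho_plus_scaleC_self)
  \<comment> \<open>Adding \<open>(- c) *\<^sub>C x\<close> back turns subadditivity into the
    reverse inequality, as \<open>rho_plus\<close> merely changes sign when \<open>c\<close>
    does.\<close>
  show "Re c * (norm x)\<^sup>2 + rho_plus x y \<le> rho_plus x (c *\<^sub>C x + y)"
    using rho_plus_add_le[of x "(- c) *\<^sub>C x" "c *\<^sub>C x + y"]
    by (simp add: rho_plus_scaleC_self, simp add: scaleC_minus_left)
qed

text \<open>Subadditivity bounds each difference by the value at \<open>y - z\<close> or
  \<open>z - y\<close>. This yields continuity in the angle, hence integrability.\<close>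

lemma rho_plus_lipschitz: "\<bar>rho_plus x y - rho_plus x z\<bar> \<le> norm x * norm (y - z)"
proof -
  have "rho_plus x u - rho_plus x v \<le> norm x * norm (u - v)" for u v
    using rho_plus_add_le[of x v "u - v"] rho_plus_upper_bound[of x "u - v"] by simp
  from this[of y z] this[of z y] show ?thesis by (simp add: norm_minus_commute)
qed

lemma continuous_on_rho_plus_cis:
  "continuous_on S (\<lambda>\<theta>. rho_plus x (cis \<theta> *\<^sub>C y))"
  unfolding continuous_on
proof
  fix \<theta> assume "\<theta> \<in> S"
  have "((\<lambda>\<phi>. norm x * (cmod (cis \<phi> - cis \<theta>) * norm y)) \<longlongrightarrow> norm x * (cmod (cis \<theta> - cis \<theta>) * norm y))
      (at \<theta> within S)"
    by (intro tendsto_intros)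
  then have lim: "((\<lambda>\<phi>. norm x * (cmod (cis \<phi> - cis \<theta>) * norm y)) \<longlongrightarrow> 0) (at \<theta> within S)"
    by simp
  have "dist (rho_plus x (cis \<phi> *\<^sub>C y)) (rho_plus x (cis \<theta> *\<^sub>C y))
      \<le> norm x * (cmod (cis \<phi> - cis \<theta>) * norm y)" for \<phi>
    using rho_plus_lipschitz[of x "cis \<phi> *\<^sub>C y" "cis \<theta> *\<^sub>C y"]
    by (simp add: dist_real_def norm_scaleC flip: scaleC_diff_left)
  then show "((\<lambda>\<phi>. rho_plus x (cis \<phi> *\<^sub>C y)) \<longlongrightarrow> rho_plus x (cis \<theta> *\<^sub>C y)) (at \<theta> within S)"
    by (intro metric_tendsto_imp_tendsto[OF lim]) (auto simp: dist_real_def)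
qed

section \<open>The integral over the circle and its conjugate homogeneity\<close>

text \<open>The piece of the shifted interval beyond \<open>p\<close> is moved back by one period,
  where it fills the gap from 0 to \<open>a\<close>.\<close>

lemma integral_periodic_shift:
  fixes f :: "real \<Rightarrow> 'b::euclidean_space"
  assumes cont: "continuous_on UNIV f" and per: "\<And>\<theta>. f (\<theta> + p) = f \<theta>"
    and a: "0 \<le> a" "a \<le> p"
  shows "integral {0..p} (\<lambda>\<theta>. f (\<theta> + a)) = integral {0..p} f"
proof -
  have int: "f integrable_on {u..v}" for u v
    using cont by (meson continuous_on_subset integrable_continuous_interval top_greatest)
  have "integral {0..p} (\<lambda>\<theta>. f (\<theta> + a)) = integral {a..p + a} f"
    using integral_shift_real_ivl[of a a "p + a" f] by simp
  also have "\<dots> = integral {a..p} f + integral {p..p + a} f"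
    using a by (intro Henstock_Kurzweil_Integration.integral_combine[symmetric] int) auto
  also have "integral {p..p + a} f = integral {0..a} f"
    using integral_shift_real_ivl[of p p "p + a" f] by (simp add: per)
  also have "integral {a..p} f + integral {0..a} f = integral {0..p} f"
    using Henstock_Kurzweil_Integration.integral_combine[of 0 a p f] a int by (simp add: add.commute)
  finally show ?thesis .
qed

lemma continuous_on_rho_infty_integrand:
  "continuous_on S (\<lambda>\<theta>. cis \<theta> * complex_of_real (rho_plus x (cis \<theta> *\<^sub>C y)))"
  by (intro continuous_intros continuous_on_rho_plus_cis)

text \<open>Rotating \<open>y\<close> shifts the angle in \<open>rho_plus\<close> by
  \<open>a\<close>; shifting the outer factor \<open>cis \<theta>\<close> along with it costs
  \<open>cis (- a)\<close>.\<close>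

lemma rho_infty_cis:
  assumes "0 \<le> a" "a \<le> 2 * pi"
  shows "rho_infty x (cis a *\<^sub>C y) = cis (- a) * rho_infty x y"
proof -
  let ?f = "\<lambda>\<theta>. cis \<theta> * complex_of_real (rho_plus x (cis \<theta> *\<^sub>C y))"
  have "?f (\<theta> + 2 * pi) = ?f \<theta>" for \<theta>
    by (simp add: cis_mult[symmetric])
  then have shift: "integral {0..2 * pi} (\<lambda>\<theta>. ?f (\<theta> + a)) = integral {0..2 * pi} ?f"
    using assms by (intro integral_periodic_shift continuous_on_rho_infty_integrand)
  have "cis \<theta> * complex_of_real (rho_plus x (cis \<theta> *\<^sub>C cis a *\<^sub>C y)) = cis (- a) * ?f (\<theta> + a)" for \<theta>
    by (simp add: scaleC_scaleC cis_mult mult.assoc[symmetric])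
  then show ?thesis
    by (simp add: rho_infty_def shift integral_mult_right)
qed

lemma rho_infty_scaleR:
  assumes "0 < r"
  shows "rho_infty x (r *\<^sub>R y) = of_real r * rho_infty x y"
proof -
  have "cis \<theta> *\<^sub>C (r *\<^sub>R y) = r *\<^sub>R (cis \<theta> *\<^sub>C y)" for \<theta>
    by (simp add: scaleR_scaleC scaleC_scaleC mult.commute)
  then have "cis \<theta> * complex_of_real (rho_plus x (cis \<theta> *\<^sub>C (r *\<^sub>R y)))
      = of_real r * (cis \<theta> * complex_of_real (rho_plus x (cis \<theta> *\<^sub>C y)))" for \<theta>
    using assms by (simp add: rho_plus_scaleR)
  then show ?thesis
    by (simp only: rho_infty_def integral_mult_right) (simp only: mult.left_commute)
qed

text \<open>With the real part written as half the sum of a number and its conjugate, the integrand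
  is the constant \<open>cnj c / 2\<close> plus a multiple of \<open>cis (2 * \<theta>)\<close>,
  which integrates to zero.\<close>

lemma has_integral_cis_times_Re:
  "((\<lambda>\<theta>. cis \<theta> * complex_of_real (Re (cis \<theta> * c))) has_integral (complex_of_real pi * cnj c)) {0..2 * pi}"
proof -
  let ?F = "\<lambda>\<theta>. cnj c * of_real \<theta> / 2 - \<i> * c * cis (2 * \<theta>) / 4"
  have eq: "cnj c / 2 - \<i> * c * (2 * (\<i> * cis (2 * \<theta>))) / 4 = cis \<theta> * complex_of_real (Re (cis \<theta> * c))" for \<theta>
  proof -
    have "cis \<theta> * complex_of_real (Re (cis \<theta> * c)) = cis \<theta> * (cis \<theta> * c + cis (- \<theta>) * cnj c) / 2"
      by (simp add: complex_eq_iff)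
    also have "\<dots> = (cis (2 * \<theta>) * c + cnj c) / 2"
      by (simp add: ring_distribs mult.assoc[symmetric] cis_mult)
    finally show ?thesis by (simp add: field_simps)
  qed
  have deriv_cis: "((\<lambda>\<theta>. cis (2 * \<theta>)) has_vector_derivative 2 * (\<i> * cis (2 * \<theta>))) (at \<theta> within S)" for \<theta> S
  proof -
    \<comment> \<open>The derivative along the real line is obtained by restricting an entire
      function.\<close>
    have "((\<lambda>z. exp (\<i> * (2 * z))) has_field_derivative 2 * (\<i> * exp (\<i> * (2 * of_real \<theta>))))
        (at (of_real \<theta>))"
      by (auto intro!: derivative_eq_intros)
    from has_vector_derivative_real_field[OF this] show ?thesis
      by (simp add: cis_conv_exp)
  qed
  have "((\<lambda>\<theta>. cis \<theta> * complex_of_real (Re (cis \<theta> * c))) has_integral (?F (2 * pi) - ?F 0)) {0..2 * pi}"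
  proof (rule fundamental_theorem_of_calculus)
    fix \<theta> :: real
    show "(?F has_vector_derivative cis \<theta> * complex_of_real (Re (cis \<theta> * c))) (at \<theta> within {0..2 * pi})"
      unfolding eq[symmetric] by (auto intro!: derivative_eq_intros deriv_cis)
  qed simp
  \<comment> \<open>Makes the oscillating term of \<open>?F\<close> agree at both endpoints.\<close>
  moreover have "cis (4 * pi) = 1"
    using cis_multiple_2pi[of 2] by (simp add: mult.commute)
  ultimately show ?thesis by (simp add: algebra_simps)
qed

lemma rho_infty_scaleC_self_add:
  "rho_infty x (c *\<^sub>C x + y) = cnj c * (of_real (norm x))\<^sup>2 + rho_infty x y"
proof -
  let ?f = "\<lambda>\<theta>. cis \<theta> * complex_of_real (rho_plus x (cis \<theta> *\<^sub>C y))"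
  have "cis \<theta> * complex_of_real (rho_plus x (cis \<theta> *\<^sub>C (c *\<^sub>C x + y)))
      = cis \<theta> * complex_of_real (Re (cis \<theta> * c)) * (of_real (norm x))\<^sup>2 + ?f \<theta>" for \<theta>
    by (simp only: scaleC_add_right scaleC_scaleC rho_plus_scaleC_self_add of_real_add of_real_mult
        of_real_power ring_distribs mult.assoc)
  moreover have "((\<lambda>\<theta>. cis \<theta> * complex_of_real (Re (cis \<theta> * c)) * (of_real (norm x))\<^sup>2 + ?f \<theta>)
      has_integral (of_real pi * cnj c * (of_real (norm x))\<^sup>2 + integral {0..2 * pi} ?f)) {0..2 * pi}"
    by (intro has_integral_add has_integral_mult_left has_integral_cis_times_Re
        integrable_integral integrable_continuous_interval continuous_on_rho_infty_integrand)
  ultimately have "integral {0..2 * pi} (\<lambda>\<theta>. cis \<theta> * complex_of_real (rho_plus x (cis \<theta> *\<^sub>C (c *\<^sub>C x + y))))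
      = of_real pi * cnj c * (of_real (norm x))\<^sup>2 + integral {0..2 * pi} ?f"
    by (simp add: integral_unique)
  then show ?thesis by (simp add: rho_infty_def field_simps)
qed

text \<open>At \<open>x = 0\<close> the Lipschitz constant is zero, so \<open>rho_plus\<close> is
  constant and equals its value at the zero vector.\<close>

lemma rho_infty_zero_left [simp]: "rho_infty 0 y = 0"
proof -
  have "rho_plus 0 z = 0" for z :: 'a
    using rho_plus_lipschitz[of 0 z 0] rho_plus_scaleC_self[of "0::'a" 0] by simp
  then show ?thesis by (simp add: rho_infty_def)
qed

lemma rho_infty_zero_right [simp]: "rho_infty x 0 = 0"
proof -
  have "rho_plus x (a *\<^sub>C 0) = 0" for a
    using rho_plus_scaleC_self[of x 0] norm_scaleC[of a "0::'a"] by simp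
  then show ?thesis by (simp add: rho_infty_def)
qed

text \<open>The polar form of \<open>\<xi>\<close> splits the scaling into a rotation and a positive
  real factor; \<open>Arg2pi\<close> lies in the range of angles that \<open>rho_infty_cis\<close>
  admits.\<close>

lemma rho_infty_scaleC: "rho_infty x (\<xi> *\<^sub>C y) = cnj \<xi> * rho_infty x y"
proof (cases "\<xi> = 0")
  case False
  have polar: "\<xi> = of_real (cmod \<xi>) * cis (Arg2pi \<xi>)"
    by (metis Arg2pi_eq cis_conv_exp)
  then have "\<xi> *\<^sub>C y = cmod \<xi> *\<^sub>R (cis (Arg2pi \<xi>) *\<^sub>C y)"
    by (metis scaleR_scaleC scaleC_scaleC)
  then have "rho_infty x (\<xi> *\<^sub>C y) = of_real (cmod \<xi>) * cis (- Arg2pi \<xi>) * rho_infty x y"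
    using False Arg2pi_ge_0[of \<xi>] Arg2pi_lt_2pi[of \<xi>]
    by (simp add: rho_infty_scaleR rho_infty_cis)
  also have "of_real (cmod \<xi>) * cis (- Arg2pi \<xi>) = cnj \<xi>"
    using arg_cong[OF polar, of cnj] by (simp add: cis_cnj)
  finally show ?thesis .
qed simp

section \<open>Equivalence of the norm bound and the inclusion of the relations\<close>

theorem theorem3p7:
  shows "(\<forall>x y :: 'a::complex_normed_vector. cmod (rho_infty x y) \<le> norm x * norm y) \<longleftrightarrow>
    (rho_infty_orthogonal :: ('a \<times> 'a) set) \<subseteq> birkhoff_james_orthogonal"
proof
  assume bound: "\<forall>x y :: 'a. cmod (rho_infty x y) \<le> norm x * norm y"
  have "norm x \<le> norm (x + \<xi> *\<^sub>C y)" if "rho_infty x y = 0" for x y :: 'a and \<xi>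
  proof (cases "x = 0")
    case False
    have "rho_infty x (x + \<xi> *\<^sub>C y) = (of_real (norm x))\<^sup>2"
      using rho_infty_scaleC_self_add[of x 1 "\<xi> *\<^sub>C y"] that
      by (simp add: scaleC_one rho_infty_scaleC)
    then have "(norm x)\<^sup>2 \<le> norm x * norm (x + \<xi> *\<^sub>C y)"
      using bound[rule_format, of x "x + \<xi> *\<^sub>C y"] by (simp add: norm_power)
    then show ?thesis using False by (simp add: power2_eq_square)
  qed simp
  then show "(rho_infty_orthogonal :: ('a \<times> 'a) set) \<subseteq> birkhoff_james_orthogonal"
    by (auto simp: rho_infty_orthogonal_def birkhoff_james_orthogonal_def)
next
  assume incl: "(rho_infty_orthogonal :: ('a \<times> 'a) set) \<subseteq> birkhoff_james_orthogonal"
  show "\<forall>x y :: 'a. cmod (rho_infty x y) \<le> norm x * norm y"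
  proof (intro allI)
    fix x y :: 'a
    show "cmod (rho_infty x y) \<le> norm x * norm y"
    \<comment> \<open>In either degenerate case the left side is zero; outside them \<open>c\<close>
      is well defined and invertible.\<close>
    proof (cases "x = 0 \<or> rho_infty x y = 0")
      case False
      define c where "c = - cnj (rho_infty x y) / (of_real (norm x))\<^sup>2"
      have c: "c \<noteq> 0" and cmod_c: "cmod c = cmod (rho_infty x y) / (norm x)\<^sup>2"
        using False by (auto simp: c_def norm_divide norm_power)
      have "rho_infty x (c *\<^sub>C x + y) = 0"
        using False by (simp add: rho_infty_scaleC_self_add c_def)
      then have "norm x \<le> norm (x + (- 1 / c) *\<^sub>C (c *\<^sub>C x + y))"
        using incl by (auto simp: rho_infty_orthogonal_def birkhoff_james_orthogonal_def)
      \<comment> \<open>This scalar was chosen to cancel the component along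
        \<open>x\<close>.\<close>
      also have "x + (- 1 / c) *\<^sub>C (c *\<^sub>C x + y) = (- 1 / c) *\<^sub>C y"
        using c scaleC_minus_left[of 1 x]
        by (simp add: scaleC_add_right scaleC_scaleC scaleC_one)
      finally have "norm x \<le> norm y / cmod c"
        by (simp add: norm_scaleC norm_divide)
      then have "cmod c * norm x \<le> norm y"
        using c by (simp add: field_simps)
      then show ?thesis
        using False by (simp add: cmod_c field_simps power2_eq_square)
    qed auto
  qed
qed

end
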